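(* There is an algorithm that solves the Online Boolean Matrix-Vector Multiplication problem in total time $O(n^2)$ on all instances in which the $n \times n$ Boolean matrix $M$ has the consecutive ones property and every vector of the online sequence $v_1,\dots,v_n$ has the consecutive ones property. Consequently, the OMv conjecture is false when restricted to such instances.
   Context: Online Boolean Matrix-Vector Multiplication (OMv): given an $n\times n$ Boolean matrix $M$ and a sequence of $n$ Boolean column vectors $v_1,\dots,v_n$ presented one after another, the algorithm must output $M\cdot v_i$ (over the Boolean semiring: multiplication is AND, addition is OR) before $v_{i+1}$ is presented. OMv conjecture: the OMv problem has no $O(n^{3-\epsilon})$-time algorithm for any $\epsilon>0$. A 0-1 matrix has the consecutive ones property if in each row the column indices holding a $1$ form an interval (a set of consecutive integers); a 0-1 column vector has the consecutive ones property if the row indices holding a $1$ form an interval. *)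

theory Defs
  imports
    Complex_Main
    "HOL-Library.Landau_Symbols"
    "Jordan_Normal_Form.Matrix"
begin

text \<open>
  A unit-cost word RAM. Registers and memory cells hold words of \<open>w\<close> bits, represented as
  natural numbers below \<open>2 ^ w\<close>; all arithmetic wraps around. The machine has a queue of input
  words and a list of output words. Programs are finite and do not depend on \<open>w\<close>.
\<close>

datatype binop = Add | Sub | Mul | Div | Mod | And | Or | Xor | Shl | Shr

type_synonym reg = nat

datatype instr =
    Const reg nat
  | Binop binop reg reg reg \<comment> \<open>operator, destination, left operand, right operand\<close>
  | Load reg reg            \<comment> \<open>destination, register holding the address\<close>
  | Store reg reg           \<comment> \<open>register holding the address, source\<close>
  | Jump nat
  | Jump_Less reg reg nat
  | Read reg
  | Write reg

type_synonym program = "instr list"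

record config =
  pc :: nat
  regs :: "reg \<Rightarrow> nat"
  mem :: "nat \<Rightarrow> nat"
  inp :: "nat list"
  outp :: "nat list"

fun eval_binop :: "nat \<Rightarrow> binop \<Rightarrow> nat \<Rightarrow> nat \<Rightarrow> nat" where
  "eval_binop w Add x y = take_bit w (x + y)"
| "eval_binop w Sub x y = take_bit w (x + 2 ^ w - y)"
| "eval_binop w Mul x y = take_bit w (x * y)"
| "eval_binop w Div x y = take_bit w (x div y)"
| "eval_binop w Mod x y = take_bit w (x mod y)"
| "eval_binop w And x y = take_bit w (Bit_Operations.and x y)"
| "eval_binop w Or x y = take_bit w (Bit_Operations.or x y)"
| "eval_binop w Xor x y = take_bit w (Bit_Operations.xor x y)"
| "eval_binop w Shl x y = take_bit w (push_bit y x)"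
| "eval_binop w Shr x y = take_bit w (drop_bit y x)"

definition set_reg :: "reg \<Rightarrow> nat \<Rightarrow> config \<Rightarrow> config" where
  "set_reg r x c = c\<lparr>pc := Suc (pc c), regs := (regs c)(r := x)\<rparr>"

text \<open>Reading from an empty input queue blocks the machine, represented by \<^const>\<open>None\<close>.\<close>

fun exec_instr :: "nat \<Rightarrow> instr \<Rightarrow> config \<Rightarrow> config option" where
  "exec_instr w (Const r k) c = Some (set_reg r (take_bit w k) c)"
| "exec_instr w (Binop f r a b) c = Some (set_reg r (eval_binop w f (regs c a) (regs c b)) c)"
| "exec_instr w (Load r a) c = Some (set_reg r (mem c (regs c a)) c)"
| "exec_instr w (Store a b) c =
     Some (c\<lparr>pc := Suc (pc c), mem := (mem c)(regs c a := regs c b)\<rparr>)"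
| "exec_instr w (Jump l) c = Some (c\<lparr>pc := l\<rparr>)"
| "exec_instr w (Jump_Less a b l) c =
     Some (c\<lparr>pc := if regs c a < regs c b then l else Suc (pc c)\<rparr>)"
| "exec_instr w (Read r) c =
     (case inp c of [] \<Rightarrow> None | x # xs \<Rightarrow> Some (set_reg r (take_bit w x) (c\<lparr>inp := xs\<rparr>)))"
| "exec_instr w (Write a) c = Some (c\<lparr>pc := Suc (pc c), outp := outp c @ [regs c a]\<rparr>)"

definition halted :: "program \<Rightarrow> config \<Rightarrow> bool" where
  "halted p c \<longleftrightarrow> pc c \<ge> length p"

definition step :: "nat \<Rightarrow> program \<Rightarrow> config \<Rightarrow> config option" where
  "step w p c = (if halted p c then None else exec_instr w (p ! pc c) c)"

fun run :: "nat \<Rightarrow> program \<Rightarrow> nat \<Rightarrow> config \<Rightarrow> config option" where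
  "run w p 0 c = Some c"
| "run w p (Suc t) c = Option.bind (step w p c) (run w p t)"

definition init_config :: "nat list \<Rightarrow> config" where
  "init_config xs = \<lparr>pc = 0, regs = (\<lambda>_. 0), mem = (\<lambda>_. 0), inp = xs, outp = []\<rparr>"

definition feed :: "nat list \<Rightarrow> config \<Rightarrow> config" where
  "feed xs c = c\<lparr>inp := inp c @ xs\<rparr>"

text \<open>
  Words of \<open>\<Theta>(log n)\<close> bits; the shift by 2 makes the logarithm positive for all \<open>n\<close>, and
  \<open>n < 2 ^ word_size \<kappa> n\<close> whenever \<open>\<kappa> > 0\<close>.
\<close>

definition word_size :: "nat \<Rightarrow> nat \<Rightarrow> nat" where
  "word_size \<kappa> n = \<kappa> * nat \<lceil>log 2 (real n + 2)\<rceil>"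

definition bool_mult_mat_vec :: "bool mat \<Rightarrow> bool vec \<Rightarrow> bool vec" where
  "bool_mult_mat_vec M v = vec (dim_row M) (\<lambda>i. \<exists>j<dim_col M. M $$ (i, j) \<and> v $ j)"

definition OMv_instances :: "nat \<Rightarrow> (bool mat \<times> bool vec list) set" where
  "OMv_instances n =
     {(M, vs). M \<in> carrier_mat n n \<and> length vs = n \<and> set vs \<subseteq> carrier_vec n}"

definition vec_words :: "bool vec \<Rightarrow> nat list" where
  "vec_words v = map of_bool (list_of_vec v)"

definition mat_words :: "bool mat \<Rightarrow> nat list" where
  "mat_words M = concat (map vec_words (rows M))"

text \<open>
  \<open>answers_online w p M vs T c\<close>: started in \<open>c\<close>, the program answers the vectors \<open>vs\<close> online and
  then halts, using at most \<open>T\<close> steps in total. A vector is put into the input queue only after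
  the answers to all its predecessors have been written.
\<close>

fun answers_online ::
  "nat \<Rightarrow> program \<Rightarrow> bool mat \<Rightarrow> bool vec list \<Rightarrow> nat \<Rightarrow> config \<Rightarrow> bool" where
  "answers_online w p M [] T c \<longleftrightarrow>
     (\<exists>t\<le>T. \<exists>c'. run w p t c = Some c' \<and> halted p c' \<and> outp c' = outp c)"
| "answers_online w p M (v # vs) T c \<longleftrightarrow>
     (\<exists>t\<le>T. \<exists>c'. run w p t (feed (vec_words v) c) = Some c' \<and>
        outp c' = outp c @ vec_words (bool_mult_mat_vec M v) \<and>
        answers_online w p M vs (T - t) c')"

definition solves_OMv_on ::
  "(bool mat \<times> bool vec list) set \<Rightarrow> program \<Rightarrow> nat \<Rightarrow> (nat \<Rightarrow> nat) \<Rightarrow> bool" where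
  "solves_OMv_on I p \<kappa> T \<longleftrightarrow>
     (\<forall>n. \<forall>(M, vs) \<in> OMv_instances n \<inter> I.
        answers_online (word_size \<kappa> n) p M vs (T n) (init_config (n # mat_words M)))"

definition OMv_solvable_in_time ::
  "(bool mat \<times> bool vec list) set \<Rightarrow> (nat \<Rightarrow> real) \<Rightarrow> bool" where
  "OMv_solvable_in_time I f \<longleftrightarrow>
     (\<exists>p \<kappa> T. solves_OMv_on I p \<kappa> T \<and> (\<lambda>n. real (T n)) \<in> O(f))"

text \<open>The unrestricted conjecture is the case \<open>I = UNIV\<close>.\<close>

definition OMv_conjecture_on :: "(bool mat \<times> bool vec list) set \<Rightarrow> bool" where
  "OMv_conjecture_on I \<longleftrightarrow>
     \<not> (\<exists>\<epsilon>::real. \<epsilon> > 0 \<and> OMv_solvable_in_time I (\<lambda>n. real n powr (3 - \<epsilon>)))"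

text \<open>The empty set counts as an interval, so all-zero rows and vectors are allowed.\<close>

definition is_interval_nat :: "nat set \<Rightarrow> bool" where
  "is_interval_nat S \<longleftrightarrow> (\<exists>a b. S = {a..<b})"

definition consecutive_ones_vec :: "bool vec \<Rightarrow> bool" where
  "consecutive_ones_vec v \<longleftrightarrow> is_interval_nat {i. i < dim_vec v \<and> v $ i}"

definition consecutive_ones_mat :: "bool mat \<Rightarrow> bool" where
  "consecutive_ones_mat M \<longleftrightarrow>
     (\<forall>i<dim_row M. is_interval_nat {j. j < dim_col M \<and> M $$ (i, j)})"

definition consecutive_ones_instances :: "(bool mat \<times> bool vec list) set" where
  "consecutive_ones_instances =
     {(M, vs). consecutive_ones_mat M \<and> (\<forall>v\<in>set vs. consecutive_ones_vec v)}"

end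

theory Submission
  imports Defs
begin

text \<open>
  A 0-1 sequence whose ones form an interval is encoded by the position \<open>r\<close> just after its last
  one (\<open>0\<close> if there is none) and \<open>l = r - c\<close>, where \<open>c\<close> is the number of ones. Both numbers are
  found in one scan, and two such sequences \<open>(l, r)\<close> and \<open>(l', r')\<close> share a one iff \<open>l < r'\<close> and
  \<open>l' < r\<close>, even if one of them is zero. So after reading \<open>M\<close> in time \<open>O(n\<^sup>2)\<close> each vector costs
  a scan in time \<open>O(n)\<close> and one comparison in time \<open>O(1)\<close> per row.
\<close>

section \<open>Interval endpoints\<close>

fun last_one :: "(nat \<Rightarrow> bool) \<Rightarrow> nat \<Rightarrow> nat" where
  "last_one f 0 = 0"
| "last_one f (Suc j) = (if f j then Suc j else last_one f j)"

fun num_ones :: "(nat \<Rightarrow> bool) \<Rightarrow> nat \<Rightarrow> nat" where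
  "num_ones f 0 = 0"
| "num_ones f (Suc j) = num_ones f j + of_bool (f j)"

definition first_one :: "(nat \<Rightarrow> bool) \<Rightarrow> nat \<Rightarrow> nat" where
  "first_one f n = last_one f n - num_ones f n"

lemma last_one_le: "last_one f n \<le> n"
  by (induction n) auto

lemma less_last_one: "i < n \<Longrightarrow> f i \<Longrightarrow> i < last_one f n"
  by (induction n) (auto simp: less_Suc_eq)

lemma last_one_attained: "last_one f n = Suc i \<Longrightarrow> i < n \<and> f i"
  by (induction n) (auto split: if_splits)

lemma num_ones_eq_card: "num_ones f n = card {i. i < n \<and> f i}"
proof (induction n)
  case (Suc n)
  have "{i. i < Suc n \<and> f i} =
      (if f n then insert n {i. i < n \<and> f i} else {i. i < n \<and> f i})"
    by (auto simp: less_Suc_eq)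
  with Suc show ?case by simp
qed simp

text \<open>All ones lie below \<open>last_one f n\<close>. Hence the subtraction in
  \<open>first_one\<close> is never truncated, and the machine subtraction that computes it does not
  wrap around.\<close>

lemma num_ones_le_last_one: "num_ones f n \<le> last_one f n"
proof -
  have "{i. i < n \<and> f i} \<subseteq> {..<last_one f n}"
    by (auto intro: less_last_one)
  from card_mono[OF _ this] show ?thesis by (simp add: num_ones_eq_card)
qed

text \<open>The second claim says that the endpoints are normalised: the all-zero sequence gets
  right end \<open>0\<close>, not an arbitrary empty pair.\<close>

lemma interval_endpoints:
  assumes "is_interval_nat {i. i < n \<and> f i}"
  shows "i < n \<and> f i \<longleftrightarrow> first_one f n \<le> i \<and> i < last_one f n"
    and "first_one f n < last_one f n \<or> last_one f n = 0"
proof -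
  obtain a b where ab: "{i. i < n \<and> f i} = {a..<b}"
    using assms by (auto simp: is_interval_nat_def)
  have mem: "i < n \<and> f i \<longleftrightarrow> a \<le> i \<and> i < b" for i
    using ab by (metis (mono_tags, lifting) atLeastLessThan_iff mem_Collect_eq)
  have cnt: "num_ones f n = b - a"
    by (simp add: num_ones_eq_card ab)
  \<comment> \<open>If \<open>a \<ge> b\<close>, the values of \<open>a\<close> and \<open>b\<close>
    are arbitrary, whereas \<open>last_one\<close> is then \<open>0\<close>.\<close>
  have *: "last_one f n = (if a < b then b else 0)"
  proof (cases "last_one f n")
    case 0
    then show ?thesis
      using mem[of a] less_last_one[of a n f] by auto
  next
    case (Suc k)
    then have "a \<le> k" "k < b"
      using last_one_attained[OF Suc] mem[of k] by auto
    \<comment> \<open>Since \<open>a \<le> k < b\<close>, the position \<open>b - 1\<close> holds a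
      one; with \<open>k < b\<close> this pins \<open>last_one f n\<close> to
      \<open>b\<close>.\<close>
    moreover have "b - 1 < last_one f n"
      using calculation mem[of "b - 1"] less_last_one[of "b - 1" n f] by auto
    ultimately show ?thesis using Suc by auto
  qed
  show "i < n \<and> f i \<longleftrightarrow> first_one f n \<le> i \<and> i < last_one f n"
    unfolding mem first_one_def * cnt by auto
  show "first_one f n < last_one f n \<or> last_one f n = 0"
    unfolding first_one_def * cnt by auto
qed

text \<open>A common position exists iff the larger left end lies below both right ends. Of the
  resulting four inequalities, the two within one interval follow from normalisation, unless a right
  end is \<open>0\<close>, when both sides are false.\<close>

lemma intervals_meet_iff:
  assumes "is_interval_nat {i. i < n \<and> f i}" and "is_interval_nat {i. i < n \<and> g i}"
  shows "(\<exists>i<n. f i \<and> g i) \<longleftrightarrow>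
    first_one f n < last_one g n \<and> first_one g n < last_one f n"
proof -
  let ?m = "max (first_one f n) (first_one g n)"
  note f = interval_endpoints[OF assms(1)] and g = interval_endpoints[OF assms(2)]
  have "(\<exists>i<n. f i \<and> g i) \<longleftrightarrow>
      (\<exists>i. first_one f n \<le> i \<and> i < last_one f n \<and> first_one g n \<le> i \<and> i < last_one g n)"
    using f(1) g(1) by blast
  also have "\<dots> \<longleftrightarrow> ?m < last_one f n \<and> ?m < last_one g n"
    by (meson le_less_trans max.bounded_iff max.cobounded1 max.cobounded2)
  finally show ?thesis
    using f(2) g(2) by auto
qed

section \<open>Reasoning about runs\<close>

text \<open>A total correctness judgement with a time bound. As \<open>T\<close> is only an upper
  bound, branches of different length can share it.\<close>

definition reaches :: "nat \<Rightarrow> program \<Rightarrow> nat \<Rightarrow> config \<Rightarrow> (config \<Rightarrow> bool) \<Rightarrow> bool" where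
  "reaches w p T c Q \<longleftrightarrow> (\<exists>t\<le>T. \<exists>c'. run w p t c = Some c' \<and> Q c')"

lemma reaches_now: "Q c \<Longrightarrow> reaches w p T c Q"
  unfolding reaches_def by (rule exI[of _ 0]) auto

lemma run_add: "run w p (s + t) c = Option.bind (run w p s c) (run w p t)"
proof (induction s arbitrary: c)
  case (Suc s)
  then show ?case by (cases "step w p c") auto
qed simp

lemma reaches_run:
  assumes "run w p s c = Some c'" and "reaches w p T c' Q" and "s + T \<le> U"
  shows "reaches w p U c Q"
proof -
  obtain t c'' where t: "t \<le> T" "run w p t c' = Some c''" "Q c''"
    using assms(2) by (auto simp: reaches_def)
  have "run w p (s + t) c = Some c''"
    using assms(1) t by (simp add: run_add)
  then show ?thesis
    unfolding reaches_def using t(1,3) assms(3) by (meson add_left_mono le_trans)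
qed

lemma reaches_trans:
  assumes "reaches w p S c P" and "\<And>c'. P c' \<Longrightarrow> reaches w p T c' Q" and "S + T \<le> U"
  shows "reaches w p U c Q"
proof -
  obtain s c' where s: "s \<le> S" "run w p s c = Some c'" "P c'"
    using assms(1) by (auto simp: reaches_def)
  obtain t c'' where t: "t \<le> T" "run w p t c' = Some c''" "Q c''"
    using assms(2)[OF s(3)] by (auto simp: reaches_def)
  have "run w p (s + t) c = Some c''"
    using s t by (simp add: run_add)
  then show ?thesis
    unfolding reaches_def using s(1) t(1,3) assms(3) by (meson add_mono le_trans)
qed

lemma step_feed: "step w p c = Some c' \<Longrightarrow> step w p (feed xs c) = Some (feed xs c')"
  by (cases "p ! pc c")
    (auto simp: step_def halted_def feed_def set_reg_def split: if_splits list.splits)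

text \<open>A program cannot test whether its queue is empty: it would block. So a run that succeeds
  never notices words appended at the end.\<close>

lemma run_feed: "run w p t c = Some c' \<Longrightarrow> run w p t (feed xs c) = Some (feed xs c')"
proof (induction t arbitrary: c)
  case (Suc t)
  then obtain d where "step w p c = Some d" "run w p t d = Some c'"
    by (cases "step w p c") auto
  then show ?case using Suc.IH[of d] step_feed[of w p c d xs] by simp
qed simp

lemma answers_online_mono:
  "answers_online w p M vs T c \<Longrightarrow> T \<le> U \<Longrightarrow> answers_online w p M vs U c"
proof (induction vs arbitrary: c T U)
  case Nil
  then show ?case by (meson answers_online.simps(1) le_trans)
next
  case (Cons v vs)
  then show ?case by (meson answers_online.simps(2) diff_le_mono le_trans)
qed

text \<open>Accounts for silent preprocessing. \<open>answers_online\<close> feeds the first vector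
  before any step is made, but by \<open>run_feed\<close> the preprocessing runs the same with that
  vector already queued.\<close>

lemma answers_online_prepend:
  assumes "reaches w p S c (\<lambda>c'. outp c' = outp c \<and> answers_online w p M vs T c')"
  shows "answers_online w p M vs (S + T) c"
proof -
  obtain s c' where s: "s \<le> S" "run w p s c = Some c'" "outp c' = outp c"
    and a: "answers_online w p M vs T c'"
    using assms by (auto simp: reaches_def)
  show ?thesis
  proof (cases vs)
    case Nil
    then obtain t c'' where "t \<le> T" "run w p t c' = Some c''" "halted p c''" "outp c'' = outp c'"
      using a by auto
    then show ?thesis
      using s Nil by (auto intro!: exI[of _ "s + t"] simp: run_add)
  next
    case (Cons v us)
    then obtain t c'' where t: "t \<le> T" "run w p t (feed (vec_words v) c') = Some c''"
      "outp c'' = outp c' @ vec_words (bool_mult_mat_vec M v)"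
      "answers_online w p M us (T - t) c''"
      using a by auto
    have "answers_online w p M us (S + T - (s + t)) c''"
      using answers_online_mono[OF t(4)] s(1) by simp
    then show ?thesis
      using s t Cons run_feed[OF s(2)] by (auto intro!: exI[of _ "s + t"] simp: run_add)
  qed
qed

section \<open>The program\<close>

text \<open>
  Registers 0 and 1 hold the constants 0 and 1, register 2 holds \<open>n\<close>, register 9 holds \<open>2n\<close>, and
  register 3 holds the index \<open>i\<close> of the current one of the \<open>2n\<close> input sequences: first the rows of
  the matrix, then the vectors. The scan (instructions 5 to 15) is shared by both kinds and leaves
  the endpoints in registers 6 and 7. For \<open>i < n\<close> they are stored at the addresses \<open>i\<close> and \<open>n + i\<close>
  (34 to 36), for \<open>i \<ge> n\<close> they are compared with all the stored ones (18 to 33).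
\<close>

definition prog :: program where
  "prog =
    [Const 1 1,             \<comment> \<open>0\<close>
     Read 2,
     Binop Add 9 2 2,
     Jump_Less 3 9 5,       \<comment> \<open>3: next sequence\<close>
     Jump 39,
     Const 4 0,             \<comment> \<open>5\<close>
     Const 6 0,
     Const 7 0,
     Jump_Less 4 2 10,      \<comment> \<open>8: next bit\<close>
     Jump 16,
     Read 5,                \<comment> \<open>10\<close>
     Binop Add 4 4 1,
     Binop Add 6 6 5,
     Jump_Less 5 1 8,
     Binop Add 7 4 0,
     Jump 8,
     Binop Sub 6 7 6,       \<comment> \<open>16\<close>
     Jump_Less 3 2 34,
     Const 4 0,
     Jump 20,
     Jump_Less 4 2 22,      \<comment> \<open>20: next row\<close>
     Jump 37,
     Load 8 4,              \<comment> \<open>22\<close>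
     Binop Add 10 4 2,
     Load 10 10,
     Const 5 0,
     Jump_Less 8 7 28,
     Jump 31,
     Jump_Less 6 10 30,     \<comment> \<open>28\<close>
     Jump 31,
     Const 5 1,             \<comment> \<open>30\<close>
     Write 5,               \<comment> \<open>31\<close>
     Binop Add 4 4 1,
     Jump 20,
     Store 3 6,             \<comment> \<open>34\<close>
     Binop Add 8 3 2,
     Store 8 7,
     Binop Add 3 3 1,       \<comment> \<open>37\<close>
     Jump 3]"

text \<open>For symbolic execution of a concrete number of steps: the equations of
  \<open>run\<close> match only \<open>0\<close> and \<open>Suc\<close>.\<close>

lemma run_numeral:
  "run w p (numeral k) c = Option.bind (step w p c) (run w p (pred_numeral k))"
  by (simp add: numeral_eq_Suc)

definition const_regs :: "nat \<Rightarrow> config \<Rightarrow> bool" where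
  "const_regs n c \<longleftrightarrow> regs c 0 = 0 \<and> regs c 1 = 1 \<and> regs c 2 = n \<and> regs c 9 = 2 * n"

lemma length_prog: "length prog = 39"
  by (simp add: prog_def)

lemmas nth_prog = arg_cong[where f = "\<lambda>p. p ! i" for i, OF prog_def]

lemmas exec = run_numeral step_def halted_def length_prog nth_prog[of "numeral k" for k]
  set_reg_def const_regs_def

section \<open>Scanning one input sequence\<close>

definition bits :: "(nat \<Rightarrow> bool) \<Rightarrow> nat \<Rightarrow> nat \<Rightarrow> nat list" where
  "bits f j n = map (\<lambda>i. of_bool (f i)) [j..<n]"

lemma bits_Cons: "j < n \<Longrightarrow> bits f j n = of_bool (f j) # bits f (Suc j) n"
  by (simp add: bits_def upt_conv_Cons)

lemma bits_self: "bits f n n = []"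
  by (simp add: bits_def)

lemma num_ones_le: "num_ones f n \<le> n"
  using num_ones_le_last_one last_one_le le_trans by blast

lemma scan_loop:
  assumes "2 * n + 1 < 2 ^ w" and "const_regs n c" and "j \<le> n" and "pc c = 8"
    and "regs c 4 = j" and "regs c 6 = num_ones f j" and "regs c 7 = last_one f j"
    and "inp c = bits f j n @ xs"
  shows "reaches w prog (8 * (n - j) + 2) c (\<lambda>c'. const_regs n c' \<and> pc c' = 16 \<and> inp c' = xs \<and>
    regs c' 6 = num_ones f n \<and> regs c' 7 = last_one f n \<and> regs c' 3 = regs c 3 \<and>
    mem c' = mem c \<and> outp c' = outp c)"
  using assms
proof (induction "n - j" arbitrary: j c)
  case 0
  then have [simp]: "j = n" by simp
  show ?case
    by (rule reaches_run[where s = 2])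
      (use 0 in \<open>auto simp: exec bits_self intro!: reaches_now\<close>)
next
  case (Suc k)
  have j: "j < n" using Suc.hyps(2) by simp
  have w: "0 < w" and [simp]: "k \<le> Suc (2 * n) \<Longrightarrow> take_bit w k = k" for k
    using Suc.prems(1) by (auto intro!: gr0I take_bit_nat_eq_self)
  let ?Q = "\<lambda>c'. const_regs n c' \<and> pc c' = 16 \<and> inp c' = xs \<and>
    regs c' 6 = num_ones f n \<and> regs c' 7 = last_one f n \<and> regs c' 3 = regs c 3 \<and>
    mem c' = mem c \<and> outp c' = outp c"
  have IH: "reaches w prog (8 * (n - Suc j) + 2) c' ?Q"
    if "const_regs n c'" "pc c' = 8" "regs c' 4 = Suc j" "regs c' 6 = num_ones f (Suc j)"
      "regs c' 7 = last_one f (Suc j)" "inp c' = bits f (Suc j) n @ xs"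
      "regs c' 3 = regs c 3" "mem c' = mem c" "outp c' = outp c" for c'
    using Suc.hyps(1)[of "Suc j" c'] Suc.hyps(2) Suc.prems(1) j that by simp
  \<comment> \<open>The states after a round that reads a zero (5 steps) or a one (7 steps); the
    bound grants 8 to either.\<close>
  let ?d0 = "c\<lparr>pc := 8, inp := bits f (Suc j) n @ xs, regs := (regs c)(5 := 0, 4 := Suc j,
    6 := num_ones f j)\<rparr>"
  let ?d1 = "c\<lparr>pc := 8, inp := bits f (Suc j) n @ xs, regs := (regs c)(5 := 1, 4 := Suc j,
    6 := Suc (num_ones f j), 7 := Suc j)\<rparr>"
  note c = Suc.prems(2,4-) bits_Cons[OF j, of f] num_ones_le[of f j] j w
  show ?case
  proof (cases "f j")
    case True
    show ?thesis
    proof (rule reaches_run)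
      show "run w prog 7 c = Some ?d1"
        using c True by (simp add: exec)
      show "reaches w prog (8 * (n - Suc j) + 2) ?d1 ?Q"
        by (rule IH) (use c True in \<open>simp_all add: const_regs_def\<close>)
    qed (use j in simp)
  next
    case False
    show ?thesis
    proof (rule reaches_run)
      show "run w prog 5 c = Some ?d0"
        using c False by (simp add: exec)
      show "reaches w prog (8 * (n - Suc j) + 2) ?d0 ?Q"
        by (rule IH) (use c False in \<open>simp_all add: const_regs_def\<close>)
    qed (use j in simp)
  qed
qed

definition at_head :: "nat \<Rightarrow> nat \<Rightarrow> config \<Rightarrow> bool" where
  "at_head n i c \<longleftrightarrow> const_regs n c \<and> pc c = 3 \<and> regs c 3 = i"

definition stored :: "(nat \<Rightarrow> nat \<Rightarrow> bool) \<Rightarrow> nat \<Rightarrow> nat \<Rightarrow> config \<Rightarrow> bool" where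
  "stored A n m c \<longleftrightarrow>
    (\<forall>k<m. mem c k = first_one (A k) n \<and> mem c (n + k) = last_one (A k) n)"

lemma scan:
  assumes "2 * n + 1 < 2 ^ w" and "at_head n i c" and "i < 2 * n" and "inp c = bits f 0 n @ xs"
  shows "reaches w prog (8 * n + 7) c (\<lambda>c'. const_regs n c' \<and> pc c' = 17 \<and> inp c' = xs \<and>
    regs c' 6 = first_one f n \<and> regs c' 7 = last_one f n \<and> regs c' 3 = i \<and>
    mem c' = mem c \<and> outp c' = outp c)"
    (is "reaches _ _ _ _ ?Q")
proof -
  define d where "d = c\<lparr>pc := 8, regs := (regs c)(4 := 0, 6 := 0, 7 := 0)\<rparr>"
  have "run w prog 4 c = Some d"
    using assms(2,3) by (simp add: exec at_head_def d_def)
  moreover have "reaches w prog (8 * n + 3) d ?Q"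
  proof (rule reaches_trans)
    show "reaches w prog (8 * (n - 0) + 2) d (\<lambda>c'. const_regs n c' \<and> pc c' = 16 \<and> inp c' = xs \<and>
      regs c' 6 = num_ones f n \<and> regs c' 7 = last_one f n \<and> regs c' 3 = regs d 3 \<and>
      mem c' = mem d \<and> outp c' = outp d)"
      by (rule scan_loop) (use assms in \<open>simp_all add: d_def at_head_def const_regs_def\<close>)
  next
    fix c'
    assume c': "const_regs n c' \<and> pc c' = 16 \<and> inp c' = xs \<and> regs c' 6 = num_ones f n \<and>
      regs c' 7 = last_one f n \<and> regs c' 3 = regs d 3 \<and> mem c' = mem d \<and> outp c' = outp d"
    \<comment> \<open>\<open>Sub\<close> adds \<open>2 ^ w\<close> before subtracting; no borrow
      occurs, so reduction modulo \<open>2 ^ w\<close> removes exactly this summand.\<close>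
    have "last_one f n + 2 ^ w - num_ones f n = first_one f n + 2 ^ w"
      using num_ones_le_last_one[of f n] by (simp add: first_one_def)
    moreover have "first_one f n < 2 ^ w"
      using last_one_le[of f n] assms(1) by (simp add: first_one_def)
    ultimately have "eval_binop w Sub (last_one f n) (num_ones f n) = first_one f n"
      by (simp add: take_bit_eq_mod)
    then have "run w prog 1 c' = Some (c'\<lparr>pc := 17, regs := (regs c')(6 := first_one f n)\<rparr>)"
      using c' by (simp add: exec del: eval_binop.simps)
    then show "reaches w prog 1 c' ?Q"
      by (rule reaches_run[where T = 0])
        (use c' assms(2) in \<open>auto simp: d_def at_head_def const_regs_def intro!: reaches_now\<close>)
  qed simp
  ultimately show ?thesis
    by (rule reaches_run) simp
qed

section \<open>Storing the endpoints of the matrix rows\<close>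

lemma store_row:
  assumes "2 * n + 1 < 2 ^ w" and "at_head n i c" and "i < n" and "stored A n i c"
    and "inp c = bits (A i) 0 n @ xs"
  shows "reaches w prog (8 * n + 13) c
    (\<lambda>c'. at_head n (Suc i) c' \<and> stored A n (Suc i) c' \<and> inp c' = xs \<and> outp c' = outp c)"
    (is "reaches _ _ _ _ ?Q")
proof (rule reaches_trans)
  show "reaches w prog (8 * n + 7) c (\<lambda>c'. const_regs n c' \<and> pc c' = 17 \<and> inp c' = xs \<and>
      regs c' 6 = first_one (A i) n \<and> regs c' 7 = last_one (A i) n \<and> regs c' 3 = i \<and>
      mem c' = mem c \<and> outp c' = outp c)"
    by (rule scan) (use assms in simp_all)
next
  fix c'
  assume c': "const_regs n c' \<and> pc c' = 17 \<and> inp c' = xs \<and>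
      regs c' 6 = first_one (A i) n \<and> regs c' 7 = last_one (A i) n \<and> regs c' 3 = i \<and>
      mem c' = mem c \<and> outp c' = outp c"
  have [simp]: "k \<le> Suc (2 * n) \<Longrightarrow> take_bit w k = k" for k
    using assms(1) by (auto intro!: take_bit_nat_eq_self)
  \<comment> \<open>The cells \<open>i\<close> and \<open>n + i\<close> written here hold no
    endpoint of an earlier row, because \<open>i < n\<close> keeps the two address blocks
    apart.\<close>
  show "reaches w prog 6 c' ?Q"
    by (rule reaches_run[where s = 6 and T = 0], use c' \<open>i < n\<close> in \<open>simp add: exec\<close>)
      (use c' assms(3,4) in
        \<open>auto simp: exec at_head_def stored_def less_Suc_eq add.commute intro!: reaches_now\<close>)
qed simp

lemma store_rows:
  assumes "2 * n + 1 < 2 ^ w" and "at_head n i c" and "i \<le> n" and "stored A n i c"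
    and "inp c = concat (map (\<lambda>i. bits (A i) 0 n) [i..<n]) @ xs"
  shows "reaches w prog ((n - i) * (8 * n + 13)) c
    (\<lambda>c'. at_head n n c' \<and> stored A n n c' \<and> inp c' = xs \<and> outp c' = outp c)"
  using assms
proof (induction "n - i" arbitrary: i c)
  case 0
  then show ?case by (simp add: reaches_now)
next
  case (Suc k)
  then have i: "i < n" "k = n - Suc i" by auto
  show ?case
  proof (rule reaches_trans)
    show "reaches w prog (8 * n + 13) c (\<lambda>c'. at_head n (Suc i) c' \<and> stored A n (Suc i) c' \<and>
        inp c' = concat (map (\<lambda>i. bits (A i) 0 n) [Suc i..<n]) @ xs \<and> outp c' = outp c)"
      by (rule store_row) (use Suc.prems i in \<open>simp_all add: upt_conv_Cons\<close>)
  next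
    fix c'
    assume "at_head n (Suc i) c' \<and> stored A n (Suc i) c' \<and>
        inp c' = concat (map (\<lambda>i. bits (A i) 0 n) [Suc i..<n]) @ xs \<and> outp c' = outp c"
    then show "reaches w prog ((n - Suc i) * (8 * n + 13)) c'
        (\<lambda>c'. at_head n n c' \<and> stored A n n c' \<and> inp c' = xs \<and> outp c' = outp c)"
      using Suc.hyps(1)[of "Suc i" c'] Suc.prems(1) i by simp
  next
    have "n - i = Suc (n - Suc i)" using i by simp
    then show "8 * n + 13 + (n - Suc i) * (8 * n + 13) \<le> (n - i) * (8 * n + 13)"
      by simp
  qed
qed

section \<open>Answering one vector\<close>

definition meets :: "nat \<Rightarrow> nat \<Rightarrow> nat \<Rightarrow> nat \<Rightarrow> bool" where
  "meets l r l' r' \<longleftrightarrow> l < r' \<and> l' < r"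

lemma answer_loop:
  assumes "2 * n + 1 < 2 ^ w" and "const_regs n c" and "stored A n n c" and "j \<le> n"
    and "pc c = 20" and "regs c 4 = j"
  shows "reaches w prog (11 * (n - j) + 2) c (\<lambda>c'. const_regs n c' \<and> pc c' = 37 \<and>
    inp c' = inp c \<and> regs c' 3 = regs c 3 \<and> mem c' = mem c \<and>
    outp c' = outp c @
      map (\<lambda>k. of_bool (meets (first_one (A k) n) (last_one (A k) n) (regs c 6) (regs c 7))) [j..<n])"
  using assms
proof (induction "n - j" arbitrary: j c)
  case 0
  then have [simp]: "j = n" by simp
  show ?case
    by (rule reaches_run[where s = 2])
      (use 0 in \<open>auto simp: exec intro!: reaches_now\<close>)
next
  case (Suc k)
  have j: "j < n" using Suc.hyps(2) by simp
  have w: "0 < w" and [simp]: "k \<le> Suc (2 * n) \<Longrightarrow> take_bit w k = k" for k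
    using Suc.prems(1) by (auto intro!: gr0I take_bit_nat_eq_self)
  let ?Q = "\<lambda>c'. const_regs n c' \<and> pc c' = 37 \<and>
    inp c' = inp c \<and> regs c' 3 = regs c 3 \<and> mem c' = mem c \<and>
    outp c' = outp c @
      map (\<lambda>k. of_bool (meets (first_one (A k) n) (last_one (A k) n) (regs c 6) (regs c 7))) [j..<n]"
  let ?b = "meets (first_one (A j) n) (last_one (A j) n) (regs c 6) (regs c 7)"
  let ?d = "c\<lparr>pc := 20, regs := (regs c)(4 := Suc j, 5 := of_bool ?b,
    8 := first_one (A j) n, 10 := last_one (A j) n), outp := outp c @ [of_bool ?b]\<rparr>"
  have m: "mem c j = first_one (A j) n" "mem c (j + n) = last_one (A j) n"
    using Suc.prems(3) j by (auto simp: stored_def add.commute)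
  note c = Suc.prems(2,5,6) m j w
  \<comment> \<open>Failure of the first comparison skips the second one and saves a step; the
    outcome of the second does not change the length.\<close>
  have "run w prog (if first_one (A j) n < regs c 7 then 11 else 10) c = Some ?d"
    using c by (auto simp: exec meets_def fun_upd_twist)
  moreover have "reaches w prog (11 * (n - Suc j) + 2) ?d ?Q"
    using Suc.hyps(1)[of "Suc j" ?d] Suc.hyps(2) Suc.prems(1-3) j
    by (simp add: const_regs_def stored_def upt_conv_Cons)
  ultimately show "reaches w prog (11 * (n - j) + 2) c ?Q"
    by (rule reaches_run) (use j in auto)
qed

text \<open>Describes the machine for arbitrary \<open>f\<close> and \<open>A\<close>; that the
  outputs are the entries of the product is left to \<open>bool_mult_words\<close>. The queue holds
  just this vector, so no later input is consulted.\<close>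

lemma answer_vector:
  assumes "2 * n + 1 < 2 ^ w" and "at_head n i c" and "n \<le> i" and "i < 2 * n" and "stored A n n c"
    and "inp c = bits f 0 n"
  shows "reaches w prog (19 * n + 14) c (\<lambda>c'. at_head n (Suc i) c' \<and> stored A n n c' \<and>
    inp c' = [] \<and> outp c' = outp c @
      map (\<lambda>k. of_bool (meets (first_one (A k) n) (last_one (A k) n) (first_one f n) (last_one f n)))
        [0..<n])"
    (is "reaches _ _ _ _ ?Q")
proof (rule reaches_trans)
  show "reaches w prog (8 * n + 7) c (\<lambda>c'. const_regs n c' \<and> pc c' = 17 \<and> inp c' = [] \<and>
      regs c' 6 = first_one f n \<and> regs c' 7 = last_one f n \<and> regs c' 3 = i \<and>
      mem c' = mem c \<and> outp c' = outp c)"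
    by (rule scan) (use assms in simp_all)
next
  fix c'
  assume c': "const_regs n c' \<and> pc c' = 17 \<and> inp c' = [] \<and>
      regs c' 6 = first_one f n \<and> regs c' 7 = last_one f n \<and> regs c' 3 = i \<and>
      mem c' = mem c \<and> outp c' = outp c"
  have [simp]: "k \<le> Suc (2 * n) \<Longrightarrow> take_bit w k = k" for k
    using assms(1) by (auto intro!: take_bit_nat_eq_self)
  define d where "d = c'\<lparr>pc := 20, regs := (regs c')(4 := 0)\<rparr>"
  have "run w prog 3 c' = Some d"
    using c' \<open>n \<le> i\<close> by (simp add: exec d_def)
  moreover have "reaches w prog (11 * n + 4) d ?Q"
  proof (rule reaches_trans)
    show "reaches w prog (11 * (n - 0) + 2) d (\<lambda>c'. const_regs n c' \<and> pc c' = 37 \<and>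
        inp c' = inp d \<and> regs c' 3 = regs d 3 \<and> mem c' = mem d \<and> outp c' = outp d @
        map (\<lambda>k. of_bool (meets (first_one (A k) n) (last_one (A k) n) (regs d 6) (regs d 7)))
          [0..<n])"
      by (rule answer_loop)
        (use assms c' in \<open>simp_all add: d_def const_regs_def stored_def\<close>)
  next
    fix e
    assume e: "const_regs n e \<and> pc e = 37 \<and>
        inp e = inp d \<and> regs e 3 = regs d 3 \<and> mem e = mem d \<and> outp e = outp d @
        map (\<lambda>k. of_bool (meets (first_one (A k) n) (last_one (A k) n) (regs d 6) (regs d 7)))
          [0..<n]"
    then have "run w prog 2 e = Some (e\<lparr>pc := 3, regs := (regs e)(3 := Suc i)\<rparr>)"
      using c' \<open>i < 2 * n\<close> by (simp add: exec d_def)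
    then show "reaches w prog 2 e ?Q"
      by (rule reaches_run[where T = 0])
        (use c' e assms(5) in
          \<open>auto simp: d_def at_head_def const_regs_def stored_def intro!: reaches_now\<close>)
  qed simp
  ultimately show "reaches w prog (11 * n + 7) c' ?Q"
    by (rule reaches_run) simp
qed simp

section \<open>Correctness and running time\<close>

lemma vec_words_bits: "v \<in> carrier_vec n \<Longrightarrow> vec_words v = bits (\<lambda>j. v $ j) 0 n"
  by (auto simp: vec_words_def bits_def list_of_vec_map)

text \<open>Here the consecutive ones property enters: an entry of the product is true iff its row
  shares a one with \<open>v\<close>, which \<open>intervals_meet_iff\<close> reduces to comparing
  endpoints.\<close>

lemma bool_mult_words:
  assumes "M \<in> carrier_mat n n" and "v \<in> carrier_vec n"
    and "consecutive_ones_mat M" and "consecutive_ones_vec v"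
  shows "vec_words (bool_mult_mat_vec M v) =
    map (\<lambda>k. of_bool (meets (first_one (\<lambda>j. M $$ (k, j)) n) (last_one (\<lambda>j. M $$ (k, j)) n)
      (first_one (($) v) n) (last_one (($) v) n))) [0..<n]"
  using assms intervals_meet_iff[of n "\<lambda>j. M $$ (k, j)" "($) v" for k]
  by (auto simp: vec_words_def bool_mult_mat_vec_def meets_def
      consecutive_ones_mat_def consecutive_ones_vec_def)

text \<open>The equation \<open>i + length vs = 2 * n\<close> ties the sequence counter to the
  vectors still to come, so the program leaves its main loop exactly when none remains. The extra 2
  steps are the failed loop test and the jump to the end.\<close>

lemma answers_online_at_head:
  assumes "2 * n + 1 < 2 ^ w" and "M \<in> carrier_mat n n" and "consecutive_ones_mat M"
    and "\<And>v. v \<in> set vs \<Longrightarrow> v \<in> carrier_vec n \<and> consecutive_ones_vec v"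
    and "at_head n i c" and "n \<le> i" and "i + length vs = 2 * n"
    and "stored (\<lambda>i j. M $$ (i, j)) n n c" and "inp c = []"
  shows "answers_online w prog M vs (length vs * (19 * n + 14) + 2) c"
  using assms(4-)
proof (induction vs arbitrary: i c)
  case Nil
  then have "run w prog 2 c = Some (c\<lparr>pc := 39\<rparr>)"
    by (simp add: exec at_head_def)
  then show ?case
    by (auto intro!: exI[of _ 2] simp: halted_def length_prog)
next
  case (Cons v vs)
  let ?T = "19 * n + 14" and ?U = "length vs * (19 * n + 14) + 2"
  have v: "v \<in> carrier_vec n" "consecutive_ones_vec v"
    using Cons.prems(1) by auto
  have "reaches w prog ?T (feed (vec_words v) c) (\<lambda>c'. at_head n (Suc i) c' \<and>
      stored (\<lambda>i j. M $$ (i, j)) n n c' \<and> inp c' = [] \<and>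
      outp c' = outp (feed (vec_words v) c) @ vec_words (bool_mult_mat_vec M v))"
    unfolding bool_mult_words[OF assms(2) v(1) assms(3) v(2)]
    by (rule answer_vector) (use assms(1) Cons.prems in
      \<open>simp_all add: feed_def at_head_def const_regs_def stored_def vec_words_bits[OF v(1)]\<close>)
  then obtain t c' where t: "t \<le> ?T" "run w prog t (feed (vec_words v) c) = Some c'"
    and c': "at_head n (Suc i) c'" "stored (\<lambda>i j. M $$ (i, j)) n n c'" "inp c' = []"
      "outp c' = outp c @ vec_words (bool_mult_mat_vec M v)"
    by (auto simp: reaches_def feed_def)
  have "answers_online w prog M vs ?U c'"
    by (rule Cons.IH[of "Suc i"]) (use c' Cons.prems in auto)
  then have "answers_online w prog M vs (length (v # vs) * ?T + 2 - t) c'"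
    by (rule answers_online_mono) (use t(1) in simp)
  moreover have "t \<le> length (v # vs) * ?T + 2"
    using t(1) by simp
  ultimately show ?case
    unfolding answers_online.simps using t(2) c'(4) by blast
qed

text \<open>The factor 2 squares the range of a word: \<open>2 ^ ?L \<ge> n + 2\<close> alone need
  not exceed \<open>2 * n + 1\<close>, but \<open>(n + 2) ^ 2\<close> does.\<close>

lemma word_size_bound: "2 * n + 1 < 2 ^ word_size 2 n"
proof -
  let ?L = "nat \<lceil>log 2 (real n + 2)\<rceil>"
  have "real n + 2 = 2 powr log 2 (real n + 2)"
    by simp
  also have "\<dots> \<le> 2 powr real ?L"
    by (intro powr_mono) (auto simp: le_nat_iff intro: real_nat_ceiling_ge)
  also have "\<dots> = 2 ^ ?L"
    by (rule powr_realpow) simp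
  finally have "real (n + 2) \<le> real (2 ^ ?L)"
    by simp
  then have L: "n + 2 \<le> 2 ^ ?L"
    using of_nat_le_iff by blast
  have "2 * n + 1 < (n + 2) ^ 2"
    by (simp add: power2_eq_square)
  also have "\<dots> \<le> (2 ^ ?L) ^ 2"
    using L by (rule power_mono) simp
  also have "\<dots> = 2 ^ word_size 2 n"
    by (simp only: word_size_def mult.commute[of 2] power_mult)
  finally show ?thesis .
qed

text \<open>The bound is the sum of \<open>3 + n * (8 * n + 13)\<close> steps for setup and rows and
  \<open>n * (19 * n + 14) + 2\<close> steps for the vectors and halting.\<close>

lemma prog_solves:
  "solves_OMv_on consecutive_ones_instances prog 2 (\<lambda>n. 27 * n ^ 2 + 27 * n + 5)"
  unfolding solves_OMv_on_def
proof (intro allI ballI, clarify)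
  fix n M vs
  assume inst: "(M, vs) \<in> OMv_instances n" "(M, vs) \<in> consecutive_ones_instances"
  let ?w = "word_size 2 n" and ?c = "init_config (n # mat_words M)"
  let ?A = "\<lambda>i j. M $$ (i, j)"
  let ?d = "?c\<lparr>pc := 3, regs := (\<lambda>_. 0)(1 := 1, 2 := n, 9 := 2 * n), inp := mat_words M\<rparr>"
  let ?V = "n * (19 * n + 14) + 2"
  note w = word_size_bound[of n]
  have M: "M \<in> carrier_mat n n" "length vs = n" "set vs \<subseteq> carrier_vec n"
    "consecutive_ones_mat M" "\<forall>v\<in>set vs. consecutive_ones_vec v"
    using inst by (auto simp: OMv_instances_def consecutive_ones_instances_def)
  have words: "mat_words M = concat (map (\<lambda>i. bits (?A i) 0 n) [0..<n])"
    using M(1) by (auto simp: mat_words_def rows_def row_def vec_words_def bits_def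
        intro!: arg_cong[where f = concat])
  have [simp]: "k \<le> Suc (2 * n) \<Longrightarrow> take_bit ?w k = k" for k
    using w by (auto intro!: take_bit_nat_eq_self)
  have "0 < ?w"
    using w by (auto intro: gr0I)
  then have "run ?w prog 3 ?c = Some ?d"
    \<comment> \<open>The first program positions do not appear as numerals, to which
      \<open>exec\<close> is restricted.\<close>
    by (simp add: exec nth_prog[of 0] nth_prog[of "Suc 0"] nth_prog[of "Suc (Suc 0)"] init_config_def mult_2)
  moreover have "reaches ?w prog ((n - 0) * (8 * n + 13)) ?d
      (\<lambda>c'. at_head n n c' \<and> stored ?A n n c' \<and> inp c' = [] \<and> outp c' = outp ?d)"
    by (rule store_rows)
      (use w in \<open>simp_all add: at_head_def const_regs_def stored_def words\<close>)
  ultimately have "reaches ?w prog (3 + n * (8 * n + 13)) ?c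
      (\<lambda>c'. at_head n n c' \<and> stored ?A n n c' \<and> inp c' = [] \<and> outp c' = outp ?d)"
    by (rule reaches_run) simp
  then have "reaches ?w prog (3 + n * (8 * n + 13)) ?c
      (\<lambda>c'. outp c' = outp ?c \<and> answers_online ?w prog M vs ?V c')"
    unfolding reaches_def
    using answers_online_at_head[OF w M(1,4), of vs n] M(2,3,5)
    by (simp add: subset_iff) blast
  then have "answers_online ?w prog M vs (3 + n * (8 * n + 13) + ?V) ?c"
    by (rule answers_online_prepend)
  then show "answers_online ?w prog M vs (27 * n ^ 2 + 27 * n + 5) ?c"
    by (simp add: algebra_simps power2_eq_square)
qed

lemma prog_time: "(\<lambda>n. real (27 * n ^ 2 + 27 * n + 5)) \<in> O(\<lambda>n. real n ^ 2)"
\<comment> \<open>59 = 27 + 27 + 5, as \<open>n\<close> and 1 are at most \<open>n ^ 2\<close> for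
  \<open>n \<ge> 1\<close>.\<close>
proof (rule bigoI[where c = 59], rule eventually_sequentiallyI[of 1])
  fix n :: nat
  assume "1 \<le> n"
  then have "n \<le> n ^ 2" "1 \<le> n ^ 2"
    by (simp_all add: power2_eq_square)
  then have "27 * n ^ 2 + 27 * n + 5 \<le> 59 * n ^ 2"
    by linarith
  then have "real (27 * n ^ 2 + 27 * n + 5) \<le> real (59 * n ^ 2)"
    using of_nat_le_iff by blast
  then show "norm (real (27 * n ^ 2 + 27 * n + 5)) \<le> 59 * norm (real n ^ 2)"
    by simp
qed

theorem theorem5:
  shows "OMv_solvable_in_time consecutive_ones_instances (\<lambda>n. real n ^ 2) \<and>
         \<not> OMv_conjecture_on consecutive_ones_instances"
proof -
  have quadratic: "OMv_solvable_in_time consecutive_ones_instances (\<lambda>n. real n ^ 2)"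
    unfolding OMv_solvable_in_time_def
    by (intro exI conjI) (rule prog_solves, rule prog_time)
  \<comment> \<open>Quadratic time refutes the restricted conjecture with
    \<open>\<epsilon> = 1\<close>.\<close>
  then have "OMv_solvable_in_time consecutive_ones_instances (\<lambda>n. real n powr (3 - 1))"
    by simp
  then have "\<exists>\<epsilon>::real. \<epsilon> > 0 \<and>
      OMv_solvable_in_time consecutive_ones_instances (\<lambda>n. real n powr (3 - \<epsilon>))"
    by (intro exI[of _ 1] conjI) simp
  with quadratic show ?thesis
    unfolding OMv_conjecture_on_def by (intro conjI notI) (assumption, erule notE)
qed

end
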